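(* Let $(Z_n)_{n\ge0}$ be the Diaconis and Freedman's chain in $\Delta_2$ with continuous weight functions $p_0,p_1,p_2$ and transition operator $P$, and let $\mathcal K_m$ be the set of all minimal $P$-absorbing compact subsets of $\Delta_2$. Then one of the following holds: 1. $\mathcal K_m$ consists of three vertices, i.e. $\mathcal K_m=\{\{\mathbf{e}_0\},\{\mathbf{e}_1\},\{\mathbf{e}_2\}\}$; 2. $\mathcal K_m$ consists of two vertices, i.e. $\mathcal K_m=\{\{\mathbf{e}_i\},\{\mathbf{e}_j\}\}$ for some $i\ne j$; 3. $\mathcal K_m$ consists of one vertex, i.e. $\mathcal K_m=\{\{\mathbf{e}_i\}\}$ for some $i$; 4. $\mathcal K_m$ consists of one edge, i.e. $\mathcal K_m=\{[\mathbf{e}_i,\mathbf{e}_j]\}$ for some $i\ne j$; 5. $\mathcal K_m$ consists of one vertex and the opposite edge, i.e. $\mathcal K_m=\{\{\mathbf{e}_k\},[\mathbf{e}_i,\mathbf{e}_j]\}$ with $\{i,j,k\}=\{0,1,2\}$; 6. $\mathcal K_m=\{K_\infty\}$ for a compact subset $K_\infty\subseteq\Delta_2$ such that $K_\infty\cap\mathring{\Delta}_2\ne\emptyset$ (this set $K_\infty$ may equal the whole of $\Delta_2$).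
   Context: $\Delta_2=\{(x_1,x_2): x_1,x_2\ge0,\ x_1+x_2\le1\}$ is the closed triangle with interior $\mathring{\Delta}_2$ and vertices $\mathbf{e}_0=(0,0)$, $\mathbf{e}_1=(1,0)$, $\mathbf{e}_2=(0,1)$; $[\mathbf{a},\mathbf{b}]$ is the closed segment. Given nonnegative continuous weight functions $p_0,p_1,p_2$ on $\Delta_2$ with $p_0+p_1+p_2\equiv1$, the Diaconis and Freedman's chain is the Markov chain on $\Delta_2$ which, when at $\mathbf{x}$, chooses the vertex $\mathbf{e}_i$ with probability $p_i(\mathbf{x})$ and then moves to $t\mathbf{x}+(1-t)\mathbf{e}_i$ with $t$ uniform on $(0,1)$. Its transition operator is $Pf(\mathbf{x})=\sum_{i=0}^2p_i(\mathbf{x})\int_0^1f(t\mathbf{x}+(1-t)\mathbf{e}_i)\,dt$ for bounded measurable $f$. A non-empty compact set $K\subseteq\Delta_2$ is $P$-absorbing if $P\mathbf{1}_{\Delta_2\setminus K}(\mathbf{x})=0$ for all $\mathbf{x}\in K$; it is minimal if it contains no proper $P$-absorbing compact subset. *)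

theory Defs
  imports "HOL-Analysis.Analysis"
begin

definition Delta2 :: "(real \<times> real) set" where
  "Delta2 = {(x1, x2). 0 \<le> x1 \<and> 0 \<le> x2 \<and> x1 + x2 \<le> 1}"

text \<open>Only the indices \<open>0\<close>, \<open>1\<close>, \<open>2\<close> are used.\<close>

definition vertex :: "nat \<Rightarrow> real \<times> real" where
  "vertex i = (if i = 1 then (1, 0) else if i = 2 then (0, 1) else (0, 0))"

text \<open>
  The transition operator of the chain which, at \<open>x\<close>, picks \<open>vertex i\<close> with probability \<open>p i x\<close>
  and moves to \<open>t x + (1 - t) vertex i\<close> with \<open>t\<close> uniform on \<open>(0, 1)\<close>. It is meaningful
  for \<open>f\<close> bounded and Borel measurable on the triangle and for \<open>x\<close> in the triangle; values of
  \<open>f\<close> and \<open>p i\<close> outside the triangle are then irrelevant.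
\<close>

definition df_operator ::
    "(nat \<Rightarrow> real \<times> real \<Rightarrow> real) \<Rightarrow> (real \<times> real \<Rightarrow> real) \<Rightarrow> real \<times> real \<Rightarrow> real" where
  "df_operator p f x =
     (\<Sum>i\<in>{0, 1, 2}. p i x * (LBINT t:{0<..<1}. f (t *\<^sub>R x + (1 - t) *\<^sub>R vertex i)))"

definition absorbing_compact ::
    "(nat \<Rightarrow> real \<times> real \<Rightarrow> real) \<Rightarrow> (real \<times> real) set \<Rightarrow> bool" where
  "absorbing_compact p K \<longleftrightarrow>
     K \<noteq> {} \<and> compact K \<and> K \<subseteq> Delta2 \<and>
     (\<forall>x\<in>K. df_operator p (indicat_real (Delta2 - K)) x = 0)"

definition minimal_absorbing ::
    "(nat \<Rightarrow> real \<times> real \<Rightarrow> real) \<Rightarrow> (real \<times> real) set set" where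
  "minimal_absorbing p =
     {K. absorbing_compact p K \<and> \<not> (\<exists>K'. K' \<subset> K \<and> absorbing_compact p K')}"

end

theory Submission
  imports Defs
begin

text \<open>
  Compactness turns the measure-theoretic condition into geometry: a compact \<open>K\<close> is absorbing
  iff for every \<open>x \<in> K\<close> and every \<open>i\<close> with \<open>p i x > 0\<close> the whole segment from \<open>x\<close> to
  \<open>vertex i\<close> lies in \<open>K\<close> (\<open>absorbing_compact_iff\<close>). This has three consequences.

  Intersections of absorbing sets are absorbing unless empty, so distinct minimal sets are
  disjoint. Some weight is positive at each point, so every absorbing set contains a vertex; hence
  a minimal one is found among the three smallest absorbing sets that contain a given vertex.

  Starting at a vertex of a minimal \<open>K\<close>, either that vertex is a trap and \<open>K\<close> is this point, or
  \<open>K\<close> contains an edge. In the latter case either the opposite vertex has weight zero along the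
  edge, and \<open>K\<close> is this edge, or the chain can leave the edge from a relatively interior point of
  it, and then \<open>K\<close> meets the interior of the triangle and contains all three vertices
  (\<open>minimal_absorbing_cases\<close>). In this last case every minimal set meets \<open>K\<close>, so \<open>K\<close> is the only
  one; otherwise the minimal sets are pairwise disjoint vertices and edges.
\<close>

section \<open>The triangle\<close>

lemma Delta2_eq_halfspaces:
  "Delta2 = {x. (- 1, 0) \<bullet> x \<le> 0} \<inter> {x. (0, - 1) \<bullet> x \<le> 0} \<inter> {x. (1, 1) \<bullet> x \<le> 1}"
  by (auto simp: Delta2_def)

lemma closed_Delta2: "closed Delta2"
  unfolding Delta2_eq_halfspaces by (intro closed_Int closed_halfspace_le)

lemma convex_Delta2: "convex Delta2"
  unfolding Delta2_eq_halfspaces by (intro convex_Int convex_halfspace_le)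

lemma compact_Delta2: "compact Delta2"
proof -
  have "Delta2 \<subseteq> cbox (0, 0) (1, 1)"
    by (auto simp: Delta2_def cbox_Pair_eq)
  then have "bounded Delta2"
    using bounded_cbox bounded_subset by blast
  then show ?thesis
    using closed_Delta2 by (simp add: compact_eq_bounded_closed)
qed

lemma vertex_in_Delta2: "vertex i \<in> Delta2"
  by (auto simp: vertex_def Delta2_def)

lemma vertex_inject:
  assumes "i \<in> {0, 1, 2}" "j \<in> {0, 1, 2}"
  shows "vertex i = vertex j \<longleftrightarrow> i = j"
  using assms by (auto simp: vertex_def)

lemma interior_Delta2_superset: "{(x, y). 0 < x \<and> 0 < y \<and> x + y < 1} \<subseteq> interior Delta2"
proof (rule interior_maximal)
  have "{(x, y). 0 < x \<and> 0 < y \<and> x + y < 1}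
      = {x. (- 1, 0) \<bullet> x < 0} \<inter> {x. (0, - 1) \<bullet> x < 0} \<inter> {x::real \<times> real. (1, 1) \<bullet> x < 1}"
    by auto
  then show "open {(x, y). 0 < x \<and> 0 < y \<and> x + y < (1::real)}"
    by (auto intro!: open_Int open_halfspace_lt)
qed (auto simp: Delta2_def)

lemma midpoint_open_edge_vertex_in_interior:
  assumes ijk: "{i, j, k} = {0, 1, 2::nat}" and x: "x \<in> open_segment (vertex i) (vertex j)"
  shows "midpoint x (vertex k) \<in> interior Delta2"
proof -
  obtain u where u: "0 < u" "u < 1" and x_eq: "x = (1 - u) *\<^sub>R vertex i + u *\<^sub>R vertex j"
    using x by (auto simp: in_segment)
  have "(i, j, k) \<in> {(0,1,2), (0,2,1), (1,0,2), (1,2,0), (2,0,1), (2,1,0)}"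
  proof -
    have onto: "0 \<in> {i, j, k}" "1 \<in> {i, j, k}" "2 \<in> {i, j, k}"
      using ijk by blast+
    have "i \<in> {0, 1, 2}" "j \<in> {0, 1, 2}" "k \<in> {0, 1, 2}"
      using ijk by blast+
    then show ?thesis
      by (elim insertE emptyE; use onto in simp)
  qed
  then have "midpoint x (vertex k) \<in> {(x, y). 0 < x \<and> 0 < y \<and> x + y < 1}"
    using u by (elim insertE emptyE; simp add: x_eq vertex_def midpoint_def diff_divide_distrib)
  then show ?thesis
    by (rule subsetD [OF interior_Delta2_superset])
qed

section \<open>Absorbing sets in terms of segments\<close>

text \<open>
  The parameters at which the segment is outside the closed set form an open set, and a non-empty
  open set has positive measure; so integrating to zero forces the segment into the set.
\<close>

lemma integral_indicator_segment_eq_0_iff: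
  fixes x v :: "'a :: euclidean_space"
  assumes K: "closed K" and x: "x \<in> K" and D: "convex D" "x \<in> D" "v \<in> D"
  shows "(LBINT t:{0<..<1}. indicat_real (D - K) (t *\<^sub>R x + (1 - t) *\<^sub>R v)) = 0
    \<longleftrightarrow> closed_segment x v \<subseteq> K"
proof -
  define \<gamma> where "\<gamma> = (\<lambda>t::real. t *\<^sub>R x + (1 - t) *\<^sub>R v)"
  define S where "S = {0<..<1} \<inter> \<gamma> -` (- K)"
  have \<gamma>_D: "\<gamma> t \<in> D" if "t \<in> {0<..<1}" for t
    using that D by (auto simp: \<gamma>_def intro!: convexD)
  have "continuous_on UNIV \<gamma>"
    unfolding \<gamma>_def by (intro continuous_intros)
  then have S_open: "open S"
    unfolding S_def using K by (intro open_Int open_vimage) auto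
  have S_meas: "S \<in> sets lborel"
    using S_open by simp
  have "emeasure lborel S \<le> emeasure lborel {0<..<1::real}"
    by (rule emeasure_mono) (auto simp: S_def)
  then have S_fin: "emeasure lborel S < \<infinity>"
    by (rule order.strict_trans1) simp
  have "(LBINT t:{0<..<1}. indicat_real (D - K) (\<gamma> t)) = (LBINT t. indicat_real S t)"
    unfolding set_lebesgue_integral_def
    by (rule Bochner_Integration.integral_cong) (auto simp: S_def indicator_def \<gamma>_D)
  also have "\<dots> = measure lborel S"
    using S_meas by simp
  finally have integral_eq: "(LBINT t:{0<..<1}. indicat_real (D - K) (\<gamma> t)) = measure lborel S" .
  have "measure lborel S = 0 \<longleftrightarrow> S = {}"
  proof
    assume "measure lborel S = 0"
    then have "S \<in> null_sets lborel"
      using S_fin S_meas by (auto simp: null_sets_def measure_def enn2real_eq_0_iff)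
    then have "negligible S"
      using negligible_iff_null_sets null_sets_completionI by blast
    then show "S = {}"
      using open_not_negligible S_open by blast
  qed simp
  also have "S = {} \<longleftrightarrow> closed_segment x v \<subseteq> K"
  proof
    assume "S = {}"
    then have \<gamma>_K: "t *\<^sub>R x + (1 - t) *\<^sub>R v \<in> K" if "0 < t" "t < 1" for t
      using that by (auto simp: S_def \<gamma>_def)
    have "(1 - t) *\<^sub>R x + t *\<^sub>R v \<in> K" if "0 < t" "t < 1" for t
      using \<gamma>_K [of "1 - t"] that by simp
    then have *: "open_segment x v \<subseteq> K"
      by (auto simp: in_segment)
    show "closed_segment x v \<subseteq> K"
    proof (cases "x = v")
      case False
      then show ?thesis
        using closure_minimal [OF * K] by simp
    qed (use x in simp)
  next
    assume *: "closed_segment x v \<subseteq> K"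
    have "\<gamma> t \<in> closed_segment x v" if "t \<in> {0<..<1}" for t
      unfolding in_segment \<gamma>_def using that by (intro exI [of _ "1 - t"]) auto
    with * show "S = {}"
      unfolding S_def by blast
  qed
  finally show ?thesis
    using integral_eq by (simp add: \<gamma>_def)
qed

locale df_weights =
  fixes p :: "nat \<Rightarrow> real \<times> real \<Rightarrow> real"
  assumes cont: "\<And>i. i \<in> {0, 1, 2} \<Longrightarrow> continuous_on Delta2 (p i)"
    and nonneg: "\<And>i x. i \<in> {0, 1, 2} \<Longrightarrow> x \<in> Delta2 \<Longrightarrow> 0 \<le> p i x"
    and sum_one: "\<And>x. x \<in> Delta2 \<Longrightarrow> p 0 x + p 1 x + p 2 x = 1"
begin

lemma absorbing_compact_iff:
  "absorbing_compact p K \<longleftrightarrow> K \<noteq> {} \<and> compact K \<and> K \<subseteq> Delta2 \<and>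
    (\<forall>x\<in>K. \<forall>i\<in>{0, 1, 2}. 0 < p i x \<longrightarrow> closed_segment x (vertex i) \<subseteq> K)"
proof -
  have "df_operator p (indicat_real (Delta2 - K)) x = 0 \<longleftrightarrow>
      (\<forall>i\<in>{0, 1, 2}. 0 < p i x \<longrightarrow> closed_segment x (vertex i) \<subseteq> K)"
    if K: "compact K" "K \<subseteq> Delta2" and x: "x \<in> K" for x
  proof -
    define I where
      "I i = (LBINT t:{0<..<1}. indicat_real (Delta2 - K) (t *\<^sub>R x + (1 - t) *\<^sub>R vertex i))" for i
    have x_D: "x \<in> Delta2"
      using K x by blast
    have I_eq_0: "I i = 0 \<longleftrightarrow> closed_segment x (vertex i) \<subseteq> K" for i
      unfolding I_def using K x x_D convex_Delta2 vertex_in_Delta2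
      by (intro integral_indicator_segment_eq_0_iff) (auto intro: compact_imp_closed)
    have "0 \<le> I i" for i
      unfolding I_def set_lebesgue_integral_def by (intro Bochner_Integration.integral_nonneg) auto
    then have "0 \<le> p i x * I i" if "i \<in> {0, 1, 2}" for i
      using nonneg [OF that x_D] by simp
    then have "df_operator p (indicat_real (Delta2 - K)) x = 0 \<longleftrightarrow>
        (\<forall>i\<in>{0, 1, 2}. p i x * I i = 0)"
      unfolding df_operator_def I_def [symmetric] by (intro sum_nonneg_eq_0_iff) auto
    also have "\<dots> \<longleftrightarrow> (\<forall>i\<in>{0, 1, 2}. 0 < p i x \<longrightarrow> I i = 0)"
      using nonneg [OF _ x_D] by (intro ball_cong refl) (auto simp: less_le)
    finally show ?thesis
      by (simp add: I_eq_0)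
  qed
  then show ?thesis
    unfolding absorbing_compact_def by (metis (no_types, lifting))
qed

lemma absorbing_segment:
  assumes "absorbing_compact p K" "x \<in> K" "i \<in> {0, 1, 2}" "0 < p i x"
  shows "closed_segment x (vertex i) \<subseteq> K"
  using assms absorbing_compact_iff by blast

lemma absorbing_Delta2: "absorbing_compact p Delta2"
  unfolding absorbing_compact_iff
  using compact_Delta2 vertex_in_Delta2 convex_Delta2 by (auto simp: closed_segment_subset)

lemma absorbing_Inter:
  assumes "\<And>K. K \<in> F \<Longrightarrow> absorbing_compact p K" "F \<noteq> {}" "\<Inter>F \<noteq> {}"
  shows "absorbing_compact p (\<Inter>F)"
proof -
  have "compact (\<Inter>F)"
    using assms by (intro compact_Inter) (auto simp: absorbing_compact_iff)
  moreover have "\<Inter>F \<subseteq> Delta2"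
    using assms by (auto simp: absorbing_compact_iff)
  moreover have "closed_segment x (vertex i) \<subseteq> \<Inter>F"
    if "x \<in> \<Inter>F" "i \<in> {0, 1, 2}" "0 < p i x" for x i
    using that assms(1) absorbing_segment by (meson InterE Inter_greatest)
  ultimately show ?thesis
    unfolding absorbing_compact_iff using assms(3) by blast
qed

lemma exists_positive_weight:
  assumes "x \<in> Delta2"
  obtains i where "i \<in> {0, 1, 2}" "0 < p i x"
proof -
  have "\<exists>i\<in>{0, 1, 2}. 0 < p i x"
    using sum_one [OF assms] by (smt (verit) insertCI)
  then show ?thesis
    using that by blast
qed

lemma absorbing_contains_vertex:
  assumes "absorbing_compact p K"
  obtains i where "i \<in> {0, 1, 2}" "vertex i \<in> K"
proof -
  obtain x where x: "x \<in> K" "x \<in> Delta2"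
    using assms by (auto simp: absorbing_compact_iff)
  then obtain i where i: "i \<in> {0, 1, 2}" "0 < p i x"
    using exists_positive_weight by blast
  then have "vertex i \<in> K"
    using absorbing_segment [OF assms x(1) i] by auto
  with i show ?thesis
    using that by blast
qed

lemma absorbing_vertex:
  assumes "i \<in> {0, 1, 2}" and "\<And>j. j \<in> {0, 1, 2} \<Longrightarrow> j \<noteq> i \<Longrightarrow> p j (vertex i) \<le> 0"
  shows "absorbing_compact p {vertex i}"
  unfolding absorbing_compact_iff
proof (intro conjI ballI impI)
  fix x j assume "x \<in> {vertex i}" "j \<in> {0, 1, 2::nat}" "0 < p j x"
  then show "closed_segment x (vertex j) \<subseteq> {vertex i}"
    using assms(2) [of j] by (cases "j = i") auto
qed (auto simp: vertex_in_Delta2)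

lemma absorbing_edge:
  assumes ijk: "{i, j, k} = {0, 1, 2::nat}"
    and zero: "\<And>x. x \<in> closed_segment (vertex i) (vertex j) \<Longrightarrow> p k x = 0"
  shows "absorbing_compact p (closed_segment (vertex i) (vertex j))"
  unfolding absorbing_compact_iff
proof (intro conjI ballI impI)
  show "closed_segment (vertex i) (vertex j) \<subseteq> Delta2"
    by (intro closed_segment_subset convex_Delta2 vertex_in_Delta2)
next
  fix x l
  assume x: "x \<in> closed_segment (vertex i) (vertex j)" and "l \<in> {0, 1, 2::nat}" "0 < p l x"
  then have "l = i \<or> l = j"
    using zero [OF x] ijk by (metis insertE less_irrefl singletonD)
  then show "closed_segment x (vertex l) \<subseteq> closed_segment (vertex i) (vertex j)"
    using x by (intro closed_segment_subset) auto
qed auto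

section \<open>Minimal absorbing sets\<close>

lemma minimal_imp_absorbing: "K \<in> minimal_absorbing p \<Longrightarrow> absorbing_compact p K"
  by (simp add: minimal_absorbing_def)

lemma minimal_eqI:
  assumes "K \<in> minimal_absorbing p" "absorbing_compact p L" "L \<subseteq> K"
  shows "L = K"
  using assms by (auto simp: minimal_absorbing_def)

lemma minimal_eq_if_common_point:
  assumes "K \<in> minimal_absorbing p" "L \<in> minimal_absorbing p" "x \<in> K" "x \<in> L"
  shows "K = L"
proof -
  have abs: "absorbing_compact p (K \<inter> L)"
    using absorbing_Inter [of "{K, L}"] assms by (auto dest: minimal_imp_absorbing)
  have "K \<inter> L = K" "K \<inter> L = L"
    by (rule minimal_eqI [OF assms(1) abs] minimal_eqI [OF assms(2) abs]; blast)+
  then show ?thesis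
    by blast
qed

text \<open>
  Every absorbing set contains one of the three sets \<open>C i\<close> below, so an inclusion-minimal one
  among these three is minimal among all absorbing sets.
\<close>

lemma minimal_absorbing_nonempty: "minimal_absorbing p \<noteq> {}"
proof -
  define C where "C i = \<Inter>{K. absorbing_compact p K \<and> vertex i \<in> K}" for i
  have C_absorbing: "absorbing_compact p (C i)" for i
    unfolding C_def using absorbing_Delta2 vertex_in_Delta2 by (intro absorbing_Inter) auto
  obtain M where M: "M \<in> C ` {0, 1, 2}" and M_min: "\<And>L. L \<in> C ` {0, 1, 2} \<Longrightarrow> L \<subseteq> M \<Longrightarrow> M = L"
  proof -
    have "finite (C ` {0, 1, 2})" "C ` {0, 1, 2} \<noteq> {}"
      by blast+
    then show ?thesis
      using that finite_has_minimal by meson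
  qed
  have "M \<subseteq> L" if L: "absorbing_compact p L" "L \<subseteq> M" for L
  proof -
    obtain i where "i \<in> {0, 1, 2}" "vertex i \<in> L"
      using L(1) by (rule absorbing_contains_vertex)
    then have "C i \<subseteq> L" "C i \<in> C ` {0, 1, 2}"
      using L by (auto simp: C_def)
    then show ?thesis
      using M_min L by blast
  qed
  then have "M \<in> minimal_absorbing p"
    using M C_absorbing by (auto simp: minimal_absorbing_def)
  then show ?thesis
    by blast
qed

text \<open>
  Leaving the edge from one of its end points would only reach another edge; by continuity of the
  weight the chain can then also leave from a relatively interior point of the edge, and this
  leads through the interior of the triangle.
\<close>

lemma absorbing_meets_interior:
  assumes K: "absorbing_compact p K" and ijk: "{i, j, k} = {0, 1, 2::nat}" and "i \<noteq> j"
    and edge: "closed_segment (vertex i) (vertex j) \<subseteq> K"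
    and x: "x \<in> closed_segment (vertex i) (vertex j)" "p k x \<noteq> 0"
  shows "vertex k \<in> K" "K \<inter> interior Delta2 \<noteq> {}"
proof -
  have in_range: "i \<in> {0, 1, 2}" "j \<in> {0, 1, 2}" "k \<in> {0, 1, 2}"
    using ijk by blast+
  have closure_eq: "closure (open_segment (vertex i) (vertex j)) = closed_segment (vertex i) (vertex j)"
    using \<open>i \<noteq> j\<close> vertex_inject in_range by auto
  have edge_D: "closed_segment (vertex i) (vertex j) \<subseteq> Delta2"
    using edge K by (auto simp: absorbing_compact_iff)
  have "continuous_on (closure (open_segment (vertex i) (vertex j))) (p k)"
    unfolding closure_eq using continuous_on_subset [OF cont edge_D] in_range by blast
  then obtain y where y: "y \<in> open_segment (vertex i) (vertex j)" "p k y \<noteq> 0"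
    using x continuous_constant_on_closure [of "open_segment (vertex i) (vertex j)" "p k" 0 x]
    unfolding closure_eq by blast
  then have y_edge: "y \<in> closed_segment (vertex i) (vertex j)"
    using segment_open_subset_closed by blast
  then have "0 < p k y"
    using nonneg [of k y] edge_D in_range y(2) by (metis less_le subsetD)
  then have seg: "closed_segment y (vertex k) \<subseteq> K"
    using absorbing_segment [OF K _ in_range(3)] edge y_edge by blast
  then show "vertex k \<in> K"
    by auto
  have "midpoint y (vertex k) \<in> K"
    using seg by (meson midpoint_in_closed_segment subsetD)
  then show "K \<inter> interior Delta2 \<noteq> {}"
    using midpoint_open_edge_vertex_in_interior [OF ijk y(1)] by blast
qed

text \<open>
  A vertex \<open>i\<close> of \<open>K\<close> that is not a trap gives positive weight to some other \<open>j\<close>, so the edge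
  between them lies in \<open>K\<close>; what remains is whether the chain can leave this edge.
\<close>

lemma minimal_absorbing_cases:
  assumes K: "K \<in> minimal_absorbing p"
  obtains (vertex) i where "i \<in> {0, 1, 2}" "K = {vertex i}"
  | (edge) i j k where "{i, j, k} = {0, 1, 2}" "i \<noteq> j"
      "K = closed_segment (vertex i) (vertex j)"
  | (interior) "\<And>i. i \<in> {0, 1, 2} \<Longrightarrow> vertex i \<in> K" "K \<inter> interior Delta2 \<noteq> {}"
proof -
  have abs: "absorbing_compact p K"
    using K by (rule minimal_imp_absorbing)
  then obtain i where i: "i \<in> {0, 1, 2}" "vertex i \<in> K"
    by (rule absorbing_contains_vertex)
  show ?thesis
  proof (cases "absorbing_compact p {vertex i}")
    case True
    then have "{vertex i} = K"
      using i by (intro minimal_eqI [OF K]) auto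
    then show ?thesis
      using i by (intro vertex) auto
  next
    case False
    then have "\<not> (\<forall>j\<in>{0, 1, 2}. j \<noteq> i \<longrightarrow> p j (vertex i) \<le> 0)"
      using absorbing_vertex [OF i(1)] by blast
    then obtain j where j: "j \<in> {0, 1, 2}" "j \<noteq> i" "0 < p j (vertex i)"
      unfolding not_le [symmetric] by blast
    obtain k where ijk: "{i, j, k} = {0, 1, 2}"
    proof -
      \<comment> \<open>The three indices add up to 3.\<close>
      have "{i, j, 3 - i - j} = {0, 1, 2}"
        using i(1) j(1,2) by auto
      then show ?thesis
        using that by blast
    qed
    have sub: "closed_segment (vertex i) (vertex j) \<subseteq> K"
      using absorbing_segment [OF abs i(2) j(1,3)] .
    show ?thesis
    proof (cases "\<forall>x\<in>closed_segment (vertex i) (vertex j). p k x = 0")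
      case True
      then have "closed_segment (vertex i) (vertex j) = K"
        using absorbing_edge [OF ijk] sub by (intro minimal_eqI [OF K]) auto
      then show ?thesis
        using j(2) by (intro edge [OF ijk]) auto
    next
      case False
      then obtain x where x: "x \<in> closed_segment (vertex i) (vertex j)" "p k x \<noteq> 0"
        by blast
      have K': "vertex k \<in> K" "K \<inter> interior Delta2 \<noteq> {}"
        using absorbing_meets_interior [OF abs ijk _ sub x] j(2) by auto
      have "vertex l \<in> K" if "l \<in> {0, 1, 2}" for l
      proof -
        have "l \<in> {i, j, k}"
          using that ijk by blast
        then show ?thesis
          using K'(1) sub by auto
      qed
      then show ?thesis
        using K'(2) by (intro interior)
    qed
  qed
qed

end

section \<open>Classification of the minimal absorbing sets\<close>

theorem theorem18:
  fixes p :: "nat \<Rightarrow> real \<times> real \<Rightarrow> real"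
  assumes cont: "\<And>i. i \<in> {0, 1, 2} \<Longrightarrow> continuous_on Delta2 (p i)"
    and nonneg: "\<And>i x. i \<in> {0, 1, 2} \<Longrightarrow> x \<in> Delta2 \<Longrightarrow> 0 \<le> p i x"
    and sum_one: "\<And>x. x \<in> Delta2 \<Longrightarrow> p 0 x + p 1 x + p 2 x = 1"
  shows
    "minimal_absorbing p = {{vertex 0}, {vertex 1}, {vertex 2}}
     \<or> (\<exists>i\<in>{0, 1, 2}. \<exists>j\<in>{0, 1, 2}. i \<noteq> j \<and>
          minimal_absorbing p = {{vertex i}, {vertex j}})
     \<or> (\<exists>i\<in>{0, 1, 2}. minimal_absorbing p = {{vertex i}})
     \<or> (\<exists>i\<in>{0, 1, 2}. \<exists>j\<in>{0, 1, 2}. i \<noteq> j \<and>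
          minimal_absorbing p = {closed_segment (vertex i) (vertex j)})
     \<or> (\<exists>i j k. {i, j, k} = {0, 1, 2} \<and>
          minimal_absorbing p = {{vertex k}, closed_segment (vertex i) (vertex j)})
     \<or> (\<exists>K. compact K \<and> K \<subseteq> Delta2 \<and> K \<inter> interior Delta2 \<noteq> {} \<and>
          minimal_absorbing p = {K})"
    (is "?three \<or> ?two \<or> ?one \<or> ?edge \<or> ?vertex_edge \<or> ?interior")
proof -
  interpret df_weights p
    using assms by unfold_locales
  consider
      (interior) K where "K \<in> minimal_absorbing p" "\<And>i. i \<in> {0, 1, 2} \<Longrightarrow> vertex i \<in> K"
        "K \<inter> interior Delta2 \<noteq> {}"
    | (edge) i j k where "{i, j, k} = {0, 1, 2}" "i \<noteq> j"
        "closed_segment (vertex i) (vertex j) \<in> minimal_absorbing p"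
    | (vertices) "\<And>K. K \<in> minimal_absorbing p \<Longrightarrow> \<exists>i\<in>{0, 1, 2}. K = {vertex i}"
  proof (cases "\<forall>K\<in>minimal_absorbing p. \<exists>i\<in>{0, 1, 2}. K = {vertex i}")
    case True
    then show ?thesis
      using that(3) by blast
  next
    case False
    then obtain K where K: "K \<in> minimal_absorbing p" "\<not> (\<exists>i\<in>{0, 1, 2}. K = {vertex i})"
      by blast
    from K(1) show ?thesis
    proof (cases rule: minimal_absorbing_cases)
      case (vertex i)
      then show ?thesis
        using K(2) by blast
    next
      case (edge i j k)
      then show ?thesis
        using that(2) [of i j k] K(1) by simp
    next
      case interior
      then show ?thesis
        using that(1) [of K] K(1) by simp
    qed
  qed
  then show ?thesis
  proof cases
    case interior
    have "L = K" if "L \<in> minimal_absorbing p" for L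
    proof -
      obtain i where "i \<in> {0, 1, 2}" "vertex i \<in> L"
        using minimal_imp_absorbing [OF \<open>L \<in> minimal_absorbing p\<close>] by (rule absorbing_contains_vertex)
      then show ?thesis
        using minimal_eq_if_common_point [OF \<open>L \<in> minimal_absorbing p\<close> interior(1)] interior(2) by blast
    qed
    then have "minimal_absorbing p = {K}"
      using interior(1) by blast
    moreover have "compact K" "K \<subseteq> Delta2"
      using minimal_imp_absorbing [OF interior(1)] by (auto simp: absorbing_compact_def)
    ultimately have ?interior
      using interior(3) by (intro exI [of _ K] conjI)
    then show ?thesis
      by (intro disjI2)
  next
    case edge
    let ?E = "closed_segment (vertex i) (vertex j)"
    have in_range: "i \<in> {0, 1, 2}" "j \<in> {0, 1, 2}"
      using edge(1) by blast+
    have "L = ?E \<or> L = {vertex k}" if L: "L \<in> minimal_absorbing p" for L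
    proof (cases "vertex i \<in> L \<or> vertex j \<in> L")
      case True
      then show ?thesis
        using minimal_eq_if_common_point [OF L edge(3)] ends_in_segment by blast
    next
      case False
      show ?thesis
        using L
      proof (cases rule: minimal_absorbing_cases)
        case (vertex l)
        then have "l \<in> {i, j, k}"
          using edge(1) by blast
        then show ?thesis
          using vertex False by auto
      next
        case (edge l m n)
        \<comment> \<open>Two edges of a triangle share a vertex.\<close>
        then have "l \<in> {i, j, k}" "m \<in> {i, j, k}"
          using \<open>{i, j, k} = {0, 1, 2}\<close> by blast+
        then show ?thesis
          using False edge(2,3) by auto
      next
        case interior
        then show ?thesis
          using False in_range by blast
      qed
    qed
    then consider "minimal_absorbing p = {?E}" | "minimal_absorbing p = {{vertex k}, ?E}"
      using edge(3) by blast
    then show ?thesis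
    proof cases
      case 1
      with in_range edge(2) have ?edge
        by (intro bexI [of _ i] bexI [of _ j] conjI)
      then show ?thesis
        by (rule disjI2 [OF disjI2 [OF disjI2 [OF disjI1]]])
    next
      case 2
      with edge(1) have ?vertex_edge
        by (intro exI conjI)
      then show ?thesis
        by (rule disjI2 [OF disjI2 [OF disjI2 [OF disjI2 [OF disjI1]]]])
    qed
  next
    case vertices
    define A where "A = {i \<in> {0, 1, 2}. {vertex i} \<in> minimal_absorbing p}"
    have eq: "minimal_absorbing p = (\<lambda>i. {vertex i}) ` A"
      using vertices by (auto simp: A_def)
    have "A \<in> Pow {0, 1, 2}"
      by (auto simp: A_def)
    then have "A \<in> {{}, {0}, {1}, {2}, {0, 1}, {0, 2}, {1, 2}, {0, 1, 2}}"
      by (simp add: Pow_insert Pow_empty) blast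
    moreover have "A \<noteq> {}"
      using minimal_absorbing_nonempty eq by blast
    ultimately have "A = {0, 1, 2}
        \<or> (\<exists>i\<in>{0, 1, 2}. \<exists>j\<in>{0, 1, 2}. i \<noteq> j \<and> A = {i, j}) \<or> (\<exists>i\<in>{0, 1, 2}. A = {i})"
      by (elim insertE emptyE) (simp_all add: doubleton_eq_iff)
    then consider "A = {0, 1, 2}"
      | i j where "i \<in> {0, 1, 2}" "j \<in> {0, 1, 2}" "i \<noteq> j" "A = {i, j}"
      | i where "i \<in> {0, 1, 2}" "A = {i}"
      by meson
    then show ?thesis
    proof cases
      case 1
      then have ?three
        using eq by simp
      then show ?thesis
        by (rule disjI1)
    next
      case (2 i j)
      then have "minimal_absorbing p = {{vertex i}, {vertex j}}"
        using eq by simp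
      with 2(1-3) have ?two
        by (intro bexI [of _ i] bexI [of _ j] conjI)
      then show ?thesis
        by (rule disjI2 [OF disjI1])
    next
      case (3 i)
      then have "minimal_absorbing p = {{vertex i}}"
        using eq by simp
      with 3(1) have ?one
        by (intro bexI [of _ i])
      then show ?thesis
        by (rule disjI2 [OF disjI2 [OF disjI1]])
    qed
  qed
qed

end
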